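(* Let $a, b \in \mathbb{R}$ with $a < b$, and let $M : [a,b]\times[a,b] \to \mathbb{R}$ be a measurable function with $\int_a^b\int_a^b |M(x,y)|^2\,dx\,dy < \infty$. Let $g : [a,b] \to \mathbb{R}$ be square-integrable, and let $u \in \mathbb{R}$ satisfy $|u| < \|M\|^{-1}$, where $\|M\| = \left(\int_a^b\int_a^b |M(x,y)|^2\,dx\,dy\right)^{1/2}$. Then the integral equation $$f(x) = g(x) + u\int_a^b M(x,y) f(y)\,dy$$ has a unique square-integrable solution $f$ on $[a,b]$; that is, there is exactly one $f \in L^2([a,b])$ for which the equation holds for almost every $x \in [a,b]$.
   Context: Integrals are with respect to Lebesgue measure. A real measurable function $\varphi$ on $[a,b]$ is square-integrable if $\int_a^b |\varphi(x)|^2\,dx < \infty$; square-integrable functions are identified when they agree almost everywhere, and $L^2([a,b])$ denotes the resulting space with norm $\|\varphi\| = \left(\int_a^b |\varphi|^2\,dx\right)^{1/2}$. If $\|M\| = 0$, then $\|M\|^{-1}$ is read as $+\infty$, so that the condition on $u$ is vacuous. *)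

theory Defs
  imports "HOL-Analysis.Analysis"
begin

text \<open>
  A function on \<open>[a,b]\<close> is a total function on \<open>real\<close> of which only the values on \<open>{a..b}\<close> matter.
  Measurability is Lebesgue (not only Borel) measurability, since \<^const>\<open>lebesgue\<close> is the completed measure.
\<close>

definition square_integrable :: "real \<Rightarrow> real \<Rightarrow> (real \<Rightarrow> real) \<Rightarrow> bool" where
  "square_integrable a b f \<longleftrightarrow>
     f \<in> borel_measurable (lebesgue_on {a..b}) \<and>
     (\<integral>\<^sup>+ x. ennreal (\<bar>f x\<bar>\<^sup>2) \<partial>lebesgue_on {a..b}) < \<infinity>"

definition L2_rel :: "real \<Rightarrow> real \<Rightarrow> ((real \<Rightarrow> real) \<times> (real \<Rightarrow> real)) set" where
  "L2_rel a b = {(f, h). square_integrable a b f \<and> square_integrable a b h \<and>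
                         (AE x in lebesgue_on {a..b}. f x = h x)}"

definition L2_space :: "real \<Rightarrow> real \<Rightarrow> (real \<Rightarrow> real) set set" where
  "L2_space a b = {f. square_integrable a b f} // L2_rel a b"

lemma equiv_L2_rel: "equiv {f. square_integrable a b f} (L2_rel a b)"
proof (rule equivI)
  show "L2_rel a b \<subseteq> {f. square_integrable a b f} \<times> {f. square_integrable a b f}"
    by (auto simp: L2_rel_def)
  show "refl_on {f. square_integrable a b f} (L2_rel a b)"
    by (auto simp: refl_on_def L2_rel_def)
  show "sym (L2_rel a b)"
    by (auto simp: sym_def L2_rel_def eq_commute)
  show "trans (L2_rel a b)"
    by (auto simp: trans_def L2_rel_def elim: AE_mp)
qed

text \<open>
  The integral of \<open>|M(x,y)|\<^sup>2\<close> over the square, as a value in \<open>[0,\<infinity>]\<close>. For Lebesgue measurable \<open>M\<close>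
  almost all sections are measurable, and the iterated integral is the integral over the square.
\<close>

definition kernel_integral :: "real \<Rightarrow> real \<Rightarrow> (real \<Rightarrow> real \<Rightarrow> real) \<Rightarrow> ennreal" where
  "kernel_integral a b M =
     (\<integral>\<^sup>+ y. (\<integral>\<^sup>+ x. ennreal (\<bar>M x y\<bar>\<^sup>2) \<partial>lebesgue_on {a..b}) \<partial>lebesgue_on {a..b})"

definition square_integrable_kernel :: "real \<Rightarrow> real \<Rightarrow> (real \<Rightarrow> real \<Rightarrow> real) \<Rightarrow> bool" where
  "square_integrable_kernel a b M \<longleftrightarrow>
     (\<lambda>(x, y). M x y) \<in> borel_measurable (lebesgue_on ({a..b} \<times> {a..b})) \<and>
     kernel_integral a b M < \<infinity>"

text \<open>
  The reciprocal of this norm has to be taken in \<^typ>\<open>ennreal\<close>, where \<open>inverse 0 = \<infinity>\<close>; in \<^typ>\<open>real\<close> it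
  would be \<open>0\<close> for a kernel of norm \<open>0\<close>.
\<close>

definition kernel_norm :: "real \<Rightarrow> real \<Rightarrow> (real \<Rightarrow> real \<Rightarrow> real) \<Rightarrow> real" where
  "kernel_norm a b M = sqrt (enn2real (kernel_integral a b M))"

text \<open>
  The integrability conjunct says that the integral in the equation exists: the Bochner integral
  of a non-integrable function is \<open>0\<close> by convention. For square-integrable \<open>M\<close> and \<open>f\<close> it holds for
  almost every \<open>x\<close> by the Cauchy-Schwarz inequality.
  The predicate depends only on the class of \<open>f\<close> in \<^const>\<open>L2_space\<close>, so requiring it of all members of
  a class is the same as requiring it of one.
\<close>

definition solves_integral_equation ::
  "real \<Rightarrow> real \<Rightarrow> (real \<Rightarrow> real \<Rightarrow> real) \<Rightarrow> (real \<Rightarrow> real) \<Rightarrow> real \<Rightarrow> (real \<Rightarrow> real) \<Rightarrow> bool" where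
  "solves_integral_equation a b M g u f \<longleftrightarrow>
     (AE x in lebesgue_on {a..b}.
        integrable (lebesgue_on {a..b}) (\<lambda>y. M x y * f y) \<and>
        f x = g x + u * (\<integral>y. M x y * f y \<partial>lebesgue_on {a..b}))"

end

theory Submission
  imports Defs
begin

text \<open>
  Let \<open>T\<close> be the integral operator with kernel \<open>M\<close> and \<open>q = \<bar>u\<bar> \<parallel>M\<parallel> < 1\<close>. By Cauchy-Schwarz,
  \<open>\<bar>T f(x)\<bar> \<le> k(x) \<parallel>f\<parallel>\<close> with \<open>k(x) = \<parallel>M(x,\<cdot>)\<parallel>\<close>, hence \<open>\<parallel>u T f\<parallel> \<le> q \<parallel>f\<parallel>\<close>, which gives uniqueness.
  For existence, the terms \<open>h\<^sub>n = (u T)\<^sup>n g\<close> of the Neumann series satisfy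
  \<open>\<bar>h\<^sub>n\<^sub>+\<^sub>1(x)\<bar> \<le> \<bar>u\<bar> k(x) q\<^sup>n \<parallel>g\<parallel>\<close>. So the series converges pointwise wherever \<open>k\<close> is finite and is
  dominated by the square-integrable function \<open>\<bar>g\<bar> + C k\<close>; dominated convergence lets \<open>T\<close> pass
  through the sum, and completeness of \<open>L\<^sup>2\<close> is not required.
\<close>

section \<open>Square integrals and the Cauchy-Schwarz inequality\<close>

lemma ennreal_abs_integral_le:
  fixes f :: "'a \<Rightarrow> real"
  shows "ennreal \<bar>\<integral>x. f x \<partial>M\<bar> \<le> (\<integral>\<^sup>+x. ennreal \<bar>f x\<bar> \<partial>M)"
proof (cases "integrable M f")
  case True
  then show ?thesis using integral_norm_bound_ennreal[of M f] by simp
\<comment> \<open>The Bochner integral of a non-integrable function is 0, so the bound holds in that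
  case too.\<close>
qed (simp add: not_integrable_integral_eq)

text \<open>The squared L^2 norm, kept in \<open>ennreal\<close> so that norm estimates can be
  stated and chained without finiteness hypotheses.\<close>

definition sq_integral :: "'a measure \<Rightarrow> ('a \<Rightarrow> real) \<Rightarrow> ennreal" where
  "sq_integral M f = (\<integral>\<^sup>+x. ennreal ((f x)\<^sup>2) \<partial>M)"

lemma sq_integral_cong_AE:
  "(AE x in M. f x = g x) \<Longrightarrow> sq_integral M f = sq_integral M g"
  unfolding sq_integral_def by (intro nn_integral_cong_AE) auto

lemma sq_integral_cmult:
  assumes [measurable]: "f \<in> borel_measurable M"
  shows "sq_integral M (\<lambda>x. c * f x) = ennreal (c\<^sup>2) * sq_integral M f"
  unfolding sq_integral_def
  by (subst nn_integral_cmult[symmetric]) (auto simp: power_mult_distrib ennreal_mult)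

text \<open>A crude substitute for the triangle inequality, from (f - g)^2 \<ge> 0. It only serves
  to show that sums have finite square integral, so the factor 2 is harmless.\<close>

lemma sq_integral_add_le:
  assumes [measurable]: "f \<in> borel_measurable M" "g \<in> borel_measurable M"
  shows "sq_integral M (\<lambda>x. f x + g x) \<le> 2 * sq_integral M f + 2 * sq_integral M g"
proof -
  have "sq_integral M (\<lambda>x. f x + g x) \<le> (\<integral>\<^sup>+x. 2 * ennreal ((f x)\<^sup>2) + 2 * ennreal ((g x)\<^sup>2) \<partial>M)"
    unfolding sq_integral_def
  proof (rule nn_integral_mono)
    fix x
    have "(f x + g x)\<^sup>2 \<le> 2 * (f x)\<^sup>2 + 2 * (g x)\<^sup>2"
      using zero_le_power2[of "f x - g x"] by (simp add: power2_eq_square algebra_simps)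
    then have "ennreal ((f x + g x)\<^sup>2) \<le> ennreal (2 * (f x)\<^sup>2 + 2 * (g x)\<^sup>2)"
      by (rule ennreal_leI)
    then show "ennreal ((f x + g x)\<^sup>2) \<le> 2 * ennreal ((f x)\<^sup>2) + 2 * ennreal ((g x)\<^sup>2)"
      by (simp add: ennreal_mult)
  qed
  also have "\<dots> = 2 * sq_integral M f + 2 * sq_integral M g"
    unfolding sq_integral_def by (subst nn_integral_add) (auto simp: nn_integral_cmult)
  finally show ?thesis .
qed

lemma sq_integral_mono_abs:
  assumes "AE x in M. \<bar>f x\<bar> \<le> \<bar>g x\<bar>"
  shows "sq_integral M f \<le> sq_integral M g"
  unfolding sq_integral_def
  by (intro nn_integral_mono_AE, use assms in eventually_elim)
     (simp add: abs_le_square_iff)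

lemma sq_integral_eq_0_iff:
  assumes [measurable]: "f \<in> borel_measurable M"
  shows "sq_integral M f = 0 \<longleftrightarrow> (AE x in M. f x = 0)"
  unfolding sq_integral_def by (subst nn_integral_0_iff_AE) auto

lemma Cauchy_Schwarz_sq_integral:
  assumes [measurable]: "f \<in> borel_measurable M" "g \<in> borel_measurable M"
  shows "(\<integral>\<^sup>+x. ennreal \<bar>f x * g x\<bar> \<partial>M)\<^sup>2 \<le> sq_integral M f * sq_integral M g"
  using Cauchy_Schwarz_nn_integral[of "\<lambda>x. ennreal \<bar>f x\<bar>" M "\<lambda>x. ennreal \<bar>g x\<bar>"]
  by (simp add: sq_integral_def abs_mult ennreal_mult ennreal_power)

lemma integrable_mult_sq_integral:
  assumes [measurable]: "f \<in> borel_measurable M" "g \<in> borel_measurable M"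
    and "sq_integral M f < \<infinity>" "sq_integral M g < \<infinity>"
  shows "integrable M (\<lambda>x. f x * g x)"
proof (rule integrableI_bounded)
  have "(\<integral>\<^sup>+x. ennreal \<bar>f x * g x\<bar> \<partial>M)\<^sup>2 < \<infinity>"
    using Cauchy_Schwarz_sq_integral[OF assms(1,2)] assms(3,4)
    by (metis ennreal_mult_less_top infinity_ennreal_def order.strict_trans1)
  then show "(\<integral>\<^sup>+x. ennreal (norm (f x * g x)) \<partial>M) < \<infinity>"
    by (simp add: power_less_top_ennreal)
qed simp

section \<open>Integral operators with square-integrable kernel\<close>

text \<open>Measurability for the product \<sigma>-algebra makes every section measurable, not just
  almost every one, and with \<sigma>-finiteness it makes \<open>kernel_op f\<close>
  measurable.\<close>

locale square_integrable_operator = sigma_finite_measure M for M :: "'a measure" +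
  fixes K :: "'a \<Rightarrow> 'a \<Rightarrow> real"
  assumes kernel_measurable [measurable]: "case_prod K \<in> borel_measurable (M \<Otimes>\<^sub>M M)"
    and kernel_finite: "(\<integral>\<^sup>+x. sq_integral M (K x) \<partial>M) < \<infinity>"
begin

definition kernel_op :: "('a \<Rightarrow> real) \<Rightarrow> 'a \<Rightarrow> real" where
  "kernel_op f x = (\<integral>y. K x y * f y \<partial>M)"

lemma section_measurable [measurable]: "x \<in> space M \<Longrightarrow> K x \<in> borel_measurable M"
  using measurable_compose_Pair1[OF _ kernel_measurable, of x] by simp

lemma kernel_op_measurable [measurable]:
  assumes [measurable]: "f \<in> borel_measurable M"
  shows "kernel_op f \<in> borel_measurable M"
  unfolding kernel_op_def[abs_def] by measurable

lemma sq_section_measurable [measurable]: "(\<lambda>x. sq_integral M (K x)) \<in> borel_measurable M"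
  unfolding sq_integral_def by measurable

lemma AE_sq_section_finite: "AE x in M. sq_integral M (K x) < \<infinity>"
  using nn_integral_PInf_AE[OF sq_section_measurable] kernel_finite
  by (auto simp: less_top)

text \<open>Cauchy-Schwarz in the second variable. Since the bound lives in \<open>ennreal\<close>,
  sections of infinite norm need no separate treatment.\<close>

lemma kernel_op_power2_le:
  assumes [measurable]: "f \<in> borel_measurable M" and "x \<in> space M"
  shows "ennreal ((kernel_op f x)\<^sup>2) \<le> sq_integral M (K x) * sq_integral M f"
proof -
  have "ennreal ((kernel_op f x)\<^sup>2) = (ennreal \<bar>kernel_op f x\<bar>)\<^sup>2"
    by (simp add: ennreal_power)
  also have "\<dots> \<le> (\<integral>\<^sup>+y. ennreal \<bar>K x y * f y\<bar> \<partial>M)\<^sup>2"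
    unfolding kernel_op_def by (intro power_mono ennreal_abs_integral_le) simp
  also have "\<dots> \<le> sq_integral M (K x) * sq_integral M f"
    using assms by (intro Cauchy_Schwarz_sq_integral) auto
  finally show ?thesis .
qed

text \<open>Integrating the pointwise bound over \<open>x\<close> bounds the operator norm by the
  Hilbert-Schmidt norm.\<close>

lemma sq_integral_kernel_op_le:
  assumes [measurable]: "f \<in> borel_measurable M"
  shows "sq_integral M (kernel_op f) \<le> (\<integral>\<^sup>+x. sq_integral M (K x) \<partial>M) * sq_integral M f"
proof -
  have "sq_integral M (kernel_op f) \<le> (\<integral>\<^sup>+x. sq_integral M (K x) * sq_integral M f \<partial>M)"
    unfolding sq_integral_def[of M "kernel_op f"] by (intro nn_integral_mono kernel_op_power2_le) auto
  also have "\<dots> = (\<integral>\<^sup>+x. sq_integral M (K x) \<partial>M) * sq_integral M f"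
    by (intro nn_integral_multc) simp
  finally show ?thesis .
qed

lemma AE_integrable_kernel_mult:
  assumes [measurable]: "f \<in> borel_measurable M" and "sq_integral M f < \<infinity>"
  shows "AE x in M. integrable M (\<lambda>y. K x y * f y)"
  using AE_sq_section_finite AE_space
  by eventually_elim (rule integrable_mult_sq_integral, use assms in auto)

text \<open>The difference of two solutions solves the homogeneous equation, so its square integral
  is at most a factor below 1 times itself; being finite, it vanishes.\<close>

lemma fredholm_unique:
  assumes [measurable]: "f \<in> borel_measurable M" "h \<in> borel_measurable M"
    and fin: "sq_integral M f < \<infinity>" "sq_integral M h < \<infinity>"
    and small: "ennreal (u\<^sup>2) * (\<integral>\<^sup>+x. sq_integral M (K x) \<partial>M) < 1"
    and f: "AE x in M. f x = g x + u * kernel_op f x"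
    and h: "AE x in M. h x = g x + u * kernel_op h x"
  shows "AE x in M. f x = h x"
proof -
  let ?S = "\<integral>\<^sup>+x. sq_integral M (K x) \<partial>M"
  define d where "d x = f x - h x" for x
  have [measurable]: "d \<in> borel_measurable M" unfolding d_def by measurable
  have "sq_integral M d \<le> 2 * sq_integral M f + 2 * sq_integral M (\<lambda>x. - 1 * h x)"
    using sq_integral_add_le[of f M "\<lambda>x. - 1 * h x"] by (simp add: d_def[abs_def])
  also have "\<dots> < \<infinity>"
    using fin by (subst sq_integral_cmult) (auto simp: ennreal_mult_less_top)
  finally have d_fin: "sq_integral M d < \<infinity>" .
  \<comment> \<open>Splitting the integral of the difference requires both products with the kernel
    to be integrable, which holds for almost every \<open>x\<close>.\<close>
  have "AE x in M. d x = u * kernel_op d x"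
    using f h AE_integrable_kernel_mult[OF assms(1) fin(1)] AE_integrable_kernel_mult[OF assms(2) fin(2)]
    by eventually_elim (simp add: d_def kernel_op_def right_diff_distrib)
  then have "sq_integral M d = ennreal (u\<^sup>2) * sq_integral M (kernel_op d)"
    by (subst sq_integral_cmult[symmetric]) (auto intro: sq_integral_cong_AE)
  also have "\<dots> \<le> (ennreal (u\<^sup>2) * ?S) * sq_integral M d"
    using sq_integral_kernel_op_le[of d] by (simp add: mult.assoc mult_left_mono)
  finally have le: "sq_integral M d \<le> (ennreal (u\<^sup>2) * ?S) * sq_integral M d" .
  have "sq_integral M d = 0"
  proof (rule ccontr)
    assume "sq_integral M d \<noteq> 0"
    \<comment> \<open>Multiplying a strict inequality in \<open>ennreal\<close> stays strict only
      for a factor that is neither 0 nor infinite, hence \<open>d_fin\<close>.\<close>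
    with small d_fin have "(ennreal (u\<^sup>2) * ?S) * sq_integral M d < 1 * sq_integral M d"
      by (intro ennreal_mult_strict_right_mono) (auto simp: zero_less_iff_neq_zero)
    with le show False by simp
  qed
  then show ?thesis
    by (subst (asm) sq_integral_eq_0_iff) (auto simp: d_def)
qed

lemma fredholm_exists:
  assumes g [measurable]: "g \<in> borel_measurable M" and g_fin: "sq_integral M g < \<infinity>"
    and small: "ennreal (u\<^sup>2) * (\<integral>\<^sup>+x. sq_integral M (K x) \<partial>M) < 1"
  obtains f where "f \<in> borel_measurable M" "sq_integral M f < \<infinity>"
    "AE x in M. f x = g x + u * kernel_op f x"
proof -
  define s where "s = enn2real (\<integral>\<^sup>+x. sq_integral M (K x) \<partial>M)"
  have s: "(\<integral>\<^sup>+x. sq_integral M (K x) \<partial>M) = ennreal s" "0 \<le> s"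
    using kernel_finite by (auto simp: s_def)
  \<comment> \<open>As \<open>enn2real\<close> sends infinity to 0, \<open>k x\<close> is the norm
    of the section only where that norm is finite, which is almost everywhere.\<close>
  define k where "k x = sqrt (enn2real (sq_integral M (K x)))" for x
  have k: "sq_integral M (K x) = ennreal ((k x)\<^sup>2)" if "sq_integral M (K x) < \<infinity>" for x
    using that by (simp add: k_def)
  have k_nonneg: "0 \<le> k x" for x
    by (simp add: k_def)
  have [measurable]: "k \<in> borel_measurable M"
    unfolding k_def by measurable
  define A where "A = sqrt (enn2real (sq_integral M g))"
  have A: "sq_integral M g = ennreal (A\<^sup>2)" "0 \<le> A"
    using g_fin by (auto simp: A_def)
  define q where "q = \<bar>u\<bar> * sqrt s"
  have q2: "q\<^sup>2 = u\<^sup>2 * s" "0 \<le> q"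
    using s by (auto simp: q_def power_mult_distrib)
  have "q\<^sup>2 < 1"
    using small s by (simp add: q2 ennreal_mult[symmetric] ennreal_less_one_iff)
  then have q1: "q < 1"
    using q2(2) by (simp add: power_less_one_iff abs_square_less_1)
  define h where "h = rec_nat g (\<lambda>n f x. u * kernel_op f x)"
  have h_0: "h 0 = g" and h_Suc: "h (Suc n) = (\<lambda>x. u * kernel_op (h n) x)" for n
    by (simp_all add: h_def)
  have h_meas [measurable]: "h n \<in> borel_measurable M" for n
    by (induction n) (simp_all add: h_0 h_Suc)
  have sq_h: "sq_integral M (h n) \<le> ennreal ((q ^ n * A)\<^sup>2)" for n
  proof (induction n)
    case (Suc n)
    have "sq_integral M (h (Suc n)) = ennreal (u\<^sup>2) * sq_integral M (kernel_op (h n))"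
      by (simp add: h_Suc sq_integral_cmult)
    also have "\<dots> \<le> ennreal (u\<^sup>2) * (ennreal s * ennreal ((q ^ n * A)\<^sup>2))"
      using order_trans[OF sq_integral_kernel_op_le[of "h n"] mult_left_mono[OF Suc]]
      by (intro mult_left_mono) (simp_all add: s(1))
    also have "\<dots> = ennreal ((q ^ Suc n * A)\<^sup>2)"
      using s q2 by (simp add: ennreal_mult[symmetric] power_mult_distrib mult.assoc)
    finally show ?case .
  qed (simp add: h_0 A)
  \<comment> \<open>One application of the operator turns the norm bound on \<open>h n\<close> into
    a pointwise bound on \<open>h (Suc n)\<close>. The term \<open>h 0 = g\<close> has no such bound
    and is treated separately in \<open>G\<close>.\<close>
  have h_le: "\<bar>h (Suc n) x\<bar> \<le> \<bar>u\<bar> * k x * A * q ^ n"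
    if x: "x \<in> space M" and fin: "sq_integral M (K x) < \<infinity>" for n x
  proof -
    have "ennreal ((kernel_op (h n) x)\<^sup>2) \<le> ennreal ((k x)\<^sup>2) * ennreal ((q ^ n * A)\<^sup>2)"
      using kernel_op_power2_le[OF h_meas x, of n] mult_left_mono[OF sq_h, of "sq_integral M (K x)" n]
      by (simp add: k[OF fin])
    then have "(kernel_op (h n) x)\<^sup>2 \<le> (k x * (q ^ n * A))\<^sup>2"
      by (simp add: ennreal_mult[symmetric] power_mult_distrib)
    then have "\<bar>kernel_op (h n) x\<bar> \<le> k x * (q ^ n * A)"
      by (subst (asm) power2_le_iff_abs_le) (use k_nonneg q2(2) A(2) in simp)
    then have "\<bar>u\<bar> * \<bar>kernel_op (h n) x\<bar> \<le> \<bar>u\<bar> * (k x * (q ^ n * A))"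
      by (intro mult_left_mono) auto
    then show ?thesis
      by (simp add: h_Suc abs_mult mult_ac)
  qed
  \<comment> \<open>\<open>B * k x\<close> is the sum of the geometric series with terms
    \<open>\<bar>u\<bar> * k x * A * q ^ n\<close>.\<close>
  define B where "B = \<bar>u\<bar> * A / (1 - q)"
  define G where "G x = \<bar>g x\<bar> + B * k x" for x
  have [measurable]: "G \<in> borel_measurable M"
    unfolding G_def by measurable
  have B: "0 \<le> B" using A q1 by (simp add: B_def)
  have summable_h: "summable (\<lambda>n. h n x)" and partial_le: "\<bar>\<Sum>i<n. h i x\<bar> \<le> G x"
    if x: "x \<in> space M" and fin: "sq_integral M (K x) < \<infinity>" for n x
  proof -
    have geo: "summable (\<lambda>n. \<bar>u\<bar> * k x * A * q ^ n)"
      using q1 q2(2) by (intro summable_mult summable_geometric) auto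
    have abs_sum: "summable (\<lambda>n. \<bar>h (Suc n) x\<bar>)"
      by (rule summable_comparison_test'[OF geo, of 0]) (use h_le[OF x fin] in auto)
    then have "summable (\<lambda>n. h (Suc n) x)"
      by (rule summable_rabs_cancel)
    then show "summable (\<lambda>n. h n x)"
      by (rule iffD1[OF summable_Suc_iff])
    have "\<bar>\<Sum>i<n. h i x\<bar> \<le> (\<Sum>i<n. \<bar>h i x\<bar>)"
      by (rule sum_abs)
    \<comment> \<open>One more term makes the sum nonempty even for \<open>n = 0\<close>, so that
      \<open>\<bar>g x\<bar>\<close> can be split off.\<close>
    also have "\<dots> \<le> (\<Sum>i<Suc n. \<bar>h i x\<bar>)"
      by simp
    also have "\<dots> = \<bar>g x\<bar> + (\<Sum>i<n. \<bar>h (Suc i) x\<bar>)"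
      by (subst sum.lessThan_Suc_shift) (simp add: h_0)
    also have "(\<Sum>i<n. \<bar>h (Suc i) x\<bar>) \<le> (\<Sum>i. \<bar>h (Suc i) x\<bar>)"
      by (intro sum_le_suminf abs_sum) auto
    also have "\<dots> \<le> (\<Sum>i. \<bar>u\<bar> * k x * A * q ^ i)"
      by (intro suminf_le abs_sum geo h_le x fin)
    also have "\<dots> = B * k x"
      using q1 q2(2) by (subst suminf_mult) (auto simp: suminf_geometric B_def)
    finally show "\<bar>\<Sum>i<n. h i x\<bar> \<le> G x"
      by (simp add: G_def)
  qed
  have sq_k: "sq_integral M k = ennreal s"
    unfolding s(1)[symmetric] sq_integral_def[of M k]
    by (intro nn_integral_cong_AE, use AE_sq_section_finite in eventually_elim) (simp add: k)
  have "sq_integral M G \<le> 2 * sq_integral M (\<lambda>x. \<bar>g x\<bar>) + 2 * sq_integral M (\<lambda>x. B * k x)"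
    unfolding G_def by (rule sq_integral_add_le) auto
  also have "\<dots> < \<infinity>"
    using g_fin by (subst sq_integral_cmult)
      (auto simp: sq_k ennreal_mult_less_top sq_integral_def[of M "\<lambda>x. \<bar>g x\<bar>"] sq_integral_def[of M g])
  finally have G_fin: "sq_integral M G < \<infinity>" .
  \<comment> \<open>Where the section has infinite norm the series may diverge and
    \<open>f x\<close> be an unspecified value; such points form a null set.\<close>
  define f where "f x = (\<Sum>n. h n x)" for x
  have [measurable]: "f \<in> borel_measurable M"
    unfolding f_def by measurable
  have f_lim: "(\<lambda>n. \<Sum>i<n. h i x) \<longlonglongrightarrow> f x"
    if "x \<in> space M" "sq_integral M (K x) < \<infinity>" for x
    using summable_h[OF that] by (simp add: f_def summable_LIMSEQ)
  have f_le: "\<bar>f x\<bar> \<le> G x" if "x \<in> space M" "sq_integral M (K x) < \<infinity>" for x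
    using tendsto_rabs[OF f_lim[OF that]] partial_le[OF that]
    by (intro LIMSEQ_le_const2) auto
  have "sq_integral M f \<le> sq_integral M G"
    by (rule sq_integral_mono_abs, use AE_space AE_sq_section_finite in eventually_elim)
       (use f_le in force)
  then have f_fin: "sq_integral M f < \<infinity>"
    using G_fin by simp
  have "f x = g x + u * kernel_op f x"
    if x: "x \<in> space M" and fin: "sq_integral M (K x) < \<infinity>" for x
  proof -
    have Kx [measurable]: "K x \<in> borel_measurable M"
      using x by simp
    have h_int: "integrable M (\<lambda>y. K x y * h i y)" for i
      using fin sq_h[of i] by (intro integrable_mult_sq_integral) (auto intro: le_less_trans)
    \<comment> \<open>With \<open>x\<close> fixed, convergence and domination hold for almost every
      \<open>y\<close>. The majorant is integrable as a product of two square-integrable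
      functions.\<close>
    have "(\<lambda>n. \<integral>y. K x y * (\<Sum>i<n. h i y) \<partial>M) \<longlonglongrightarrow> (\<integral>y. K x y * f y \<partial>M)"
    proof (rule integral_dominated_convergence[where w = "\<lambda>y. \<bar>K x y * G y\<bar>"])
      show "integrable M (\<lambda>y. \<bar>K x y * G y\<bar>)"
        using fin G_fin by (intro integrable_abs integrable_mult_sq_integral) auto
      show "AE y in M. (\<lambda>n. K x y * (\<Sum>i<n. h i y)) \<longlonglongrightarrow> K x y * f y"
        using AE_space AE_sq_section_finite by eventually_elim (intro tendsto_mult_left f_lim)
      show "AE y in M. norm (K x y * (\<Sum>i<n. h i y)) \<le> \<bar>K x y * G y\<bar>" for n
        using AE_space AE_sq_section_finite
      proof eventually_elim
        case (elim y)
        have "\<bar>\<Sum>i<n. h i y\<bar> \<le> \<bar>G y\<bar>"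
          using partial_le[OF elim, of n] by simp
        then show ?case
          by (simp add: abs_mult mult_left_mono)
      qed
    qed auto
    moreover have "(\<integral>y. K x y * (\<Sum>i<n. h i y) \<partial>M) = (\<Sum>i<n. kernel_op (h i) x)" for n
      using h_int by (simp add: sum_distrib_left kernel_op_def)
    ultimately have "(\<lambda>n. g x + u * (\<Sum>i<n. kernel_op (h i) x)) \<longlonglongrightarrow> g x + u * kernel_op f x"
      unfolding kernel_op_def[of f] by (intro tendsto_intros) simp
    \<comment> \<open>Applying the right-hand side of the equation to a partial sum yields the next
      partial sum, so both sides have the same limit.\<close>
    moreover have "g x + u * (\<Sum>i<n. kernel_op (h i) x) = (\<Sum>i<Suc n. h i x)" for n
      by (subst sum.lessThan_Suc_shift) (simp add: h_0 h_Suc sum_distrib_left)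
    ultimately have "(\<lambda>n. \<Sum>i<Suc n. h i x) \<longlonglongrightarrow> g x + u * kernel_op f x"
      by simp
    then show ?thesis
      using LIMSEQ_Suc[OF f_lim[OF x fin]] LIMSEQ_unique by blast
  qed
  then have "AE x in M. f x = g x + u * kernel_op f x"
    using AE_space AE_sq_section_finite by (auto elim: eventually_elim2)
  with \<open>f \<in> borel_measurable M\<close> f_fin show thesis
    by (rule that)
qed

end

section \<open>Borel versions of Lebesgue measurable kernels\<close>

lemma (in pair_sigma_finite) AE_pair_swapped:
  assumes "AE p in M1 \<Otimes>\<^sub>M M2. Q p"
  shows "AE y in M2. AE x in M1. Q (x, y)"
proof -
  interpret swap: pair_sigma_finite M2 M1 ..
  \<comment> \<open>Exchanging the coordinates carries one product measure to the other, so the null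
    set can be sliced in the other direction.\<close>
  have "AE p in distr (M2 \<Otimes>\<^sub>M M1) (M1 \<Otimes>\<^sub>M M2) (\<lambda>(x, y). (y, x)). Q p"
    using assms by (subst (asm) distr_pair_swap)
  from swap.AE_pair[OF AE_distrD[OF measurable_pair_swap' this]] show ?thesis
    by simp
qed

text \<open>Completeness of Lebesgue measure: a change on a null set preserves measurability. This
  gives measurability of integrands involving sections of the original kernel.\<close>

lemma borel_measurable_lebesgue_on_AE:
  fixes f g :: "real \<Rightarrow> real"
  assumes f: "f \<in> borel_measurable (lebesgue_on S)" and S: "S \<in> sets lebesgue"
    and ae: "AE x in lebesgue_on S. f x = g x"
  shows "g \<in> borel_measurable (lebesgue_on S)"
proof (rule borel_measurable_if_D, rule borel_measurable_AE)
  show "(\<lambda>x. if x \<in> S then f x else 0) \<in> borel_measurable lebesgue"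
    using f S by (rule borel_measurable_if_I)
  show "AE x in lebesgue. (if x \<in> S then f x else 0) = (if x \<in> S then g x else 0)"
    using ae S by (auto simp: AE_restrict_space_iff elim: eventually_mono)
qed

text \<open>
  A Lebesgue measurable kernel need not be measurable with respect to the product
  \<open>\<sigma>\<close>-algebra; hence the passage to a Borel version.
\<close>

lemma borel_kernel_version:
  fixes M :: "real \<Rightarrow> real \<Rightarrow> real"
  assumes "(\<lambda>(x, y). M x y) \<in> borel_measurable (lebesgue_on (S \<times> T))"
    and S: "S \<in> sets borel" and T: "T \<in> sets borel"
  obtains N where "case_prod N \<in> borel_measurable (borel :: (real \<times> real) measure)"
    "AE x in lebesgue_on S. AE y in lebesgue_on T. M x y = N x y"
    "AE y in lebesgue_on T. AE x in lebesgue_on S. M x y = N x y"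
proof -
  have ST: "S \<times> T \<in> sets (borel :: (real \<times> real) measure)"
    using pair_measureI[OF S T] unfolding borel_prod .
  have "(\<lambda>p. if p \<in> S \<times> T then case_prod M p else 0) \<in> borel_measurable lebesgue"
    using assms(1) ST by (intro borel_measurable_if_I) (auto simp: split_def)
  then obtain N where N: "N \<in> borel_measurable lborel"
    "AE p in lborel. (if p \<in> S \<times> T then case_prod M p else 0) = N p"
    using completion_ex_borel_measurable_real by blast
  have ae: "AE p in lborel \<Otimes>\<^sub>M lborel. (if p \<in> S \<times> T then case_prod M p else 0) = N p"
    using N(2) unfolding lborel_prod .
  show thesis
  proof
    show "case_prod (curry N) \<in> borel_measurable borel"
      using N(1) by simp
    \<comment> \<open>Both orders of slicing are needed: this one for the operator, which integrates
      over \<open>y\<close>, the other for \<open>kernel_integral\<close>, whose inner integral is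
      over \<open>x\<close>.\<close>
    show "AE x in lebesgue_on S. AE y in lebesgue_on T. M x y = curry N x y"
      using S T lborel_pair.AE_pair[OF ae]
      by (auto simp: AE_restrict_space_iff AE_completion_iff elim!: eventually_mono)
    show "AE y in lebesgue_on T. AE x in lebesgue_on S. M x y = curry N x y"
      using S T lborel_pair.AE_pair_swapped[OF ae]
      by (auto simp: AE_restrict_space_iff AE_completion_iff elim!: eventually_mono)
  qed
qed

section \<open>The integral equation on an interval\<close>

lemma square_integrable_iff:
  "square_integrable a b f \<longleftrightarrow>
    f \<in> borel_measurable (lebesgue_on {a..b}) \<and> sq_integral (lebesgue_on {a..b}) f < \<infinity>"
  by (simp add: square_integrable_def sq_integral_def)

theorem theorem5:
  fixes a b u :: real and M :: "real \<Rightarrow> real \<Rightarrow> real" and g :: "real \<Rightarrow> real"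
  assumes "a < b"
    and "square_integrable_kernel a b M"
    and "square_integrable a b g"
    and "ennreal \<bar>u\<bar> < inverse (ennreal (kernel_norm a b M))"
  shows "\<exists>!F. F \<in> L2_space a b \<and> (\<forall>f\<in>F. solves_integral_equation a b M g u f)"
proof -
  let ?L = "lebesgue_on {a..b}"
  obtain N where N: "case_prod N \<in> borel_measurable (borel :: (real \<times> real) measure)"
    and MN: "AE x in ?L. AE y in ?L. M x y = N x y"
    and NM: "AE y in ?L. AE x in ?L. M x y = N x y"
    using assms(2) unfolding square_integrable_kernel_def
    by (elim conjE) (rule borel_kernel_version[of M "{a..b}" "{a..b}"], auto)
  interpret finite_measure ?L
    by (intro finite_measure_lebesgue_on) simp
  interpret pair_sigma_finite ?L ?L
    by unfold_locales
  have id_L: "(\<lambda>x. x) \<in> ?L \<rightarrow>\<^sub>M borel"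
    by (simp add: measurable_completion measurable_restrict_space1)
  have N_L: "case_prod N \<in> borel_measurable (?L \<Otimes>\<^sub>M ?L)"
  proof -
    have "(\<lambda>p. (fst p, snd p)) \<in> ?L \<Otimes>\<^sub>M ?L \<rightarrow>\<^sub>M borel \<Otimes>\<^sub>M borel"
      by (intro measurable_Pair measurable_compose[OF measurable_fst id_L]
          measurable_compose[OF measurable_snd id_L])
    from measurable_compose[OF this, of "case_prod N" borel] N show ?thesis
      by (simp add: borel_prod)
  qed
  \<comment> \<open>The order of integration is reversed for the Borel version \<open>N\<close>,
    where Fubini applies, before returning to \<open>M\<close>.\<close>
  have "(\<integral>\<^sup>+x. sq_integral ?L (N x) \<partial>?L) = (\<integral>\<^sup>+y. \<integral>\<^sup>+x. ennreal ((N x y)\<^sup>2) \<partial>?L \<partial>?L)"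
    unfolding sq_integral_def
    using Fubini[of "\<lambda>(x, y). ennreal ((N x y)\<^sup>2)"] N_L by simp
  also have "\<dots> = kernel_integral a b M"
    unfolding kernel_integral_def
    by (intro nn_integral_cong_AE, use NM in eventually_elim)
       (intro nn_integral_cong_AE, auto elim: eventually_mono)
  finally have sq_N: "(\<integral>\<^sup>+x. sq_integral ?L (N x) \<partial>?L) = kernel_integral a b M" .
  have fin: "kernel_integral a b M < \<infinity>"
    using assms(2) by (simp add: square_integrable_kernel_def)
  interpret square_integrable_operator ?L N
    using N_L fin by unfold_locales (simp_all add: sq_N)
  \<comment> \<open>For almost every \<open>x\<close> the sections of \<open>M\<close> and
    \<open>N\<close> agree almost everywhere, and integrability is automatic for square-integrable
    \<open>f\<close>, so that conjunct drops out.\<close>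
  have solves_iff: "solves_integral_equation a b M g u f \<longleftrightarrow>
      (AE x in ?L. f x = g x + u * kernel_op f x)" if f: "square_integrable a b f" for f
  proof -
    have f_meas [measurable]: "f \<in> borel_measurable ?L" and "sq_integral ?L f < \<infinity>"
      using f by (auto simp: square_integrable_iff)
    then have int: "AE x in ?L. integrable ?L (\<lambda>y. N x y * f y)"
      by (rule AE_integrable_kernel_mult)
    have eq: "AE x in ?L. integrable ?L (\<lambda>y. M x y * f y) \<and>
        (\<integral>y. M x y * f y \<partial>?L) = kernel_op f x"
      using int MN
    proof eventually_elim
      case (elim x)
      have N_meas: "(\<lambda>y. N x y * f y) \<in> borel_measurable ?L"
        using elim(1) by (rule borel_measurable_integrable)
      have ae: "AE y in ?L. N x y * f y = M x y * f y"
        using elim(2) by eventually_elim simp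
      have M_meas: "(\<lambda>y. M x y * f y) \<in> borel_measurable ?L"
        using N_meas _ ae by (rule borel_measurable_lebesgue_on_AE) simp
      show ?case
        using integrable_cong_AE[OF N_meas M_meas ae] integral_cong_AE[OF N_meas M_meas ae] elim(1)
        by (simp add: kernel_op_def)
    qed
    show ?thesis
      unfolding solves_integral_equation_def
      by (intro eventually_subst, use eq in eventually_elim) simp
  qed
  have small: "ennreal (u\<^sup>2) * (\<integral>\<^sup>+x. sq_integral ?L (N x) \<partial>?L) < 1"
  proof -
    let ?m = "kernel_norm a b M"
    have m: "0 \<le> ?m" "kernel_integral a b M = ennreal (?m\<^sup>2)"
      using fin by (auto simp: kernel_norm_def)
    have "\<bar>u\<bar> * ?m < 1"
    \<comment> \<open>For norm 0 the hypothesis on \<open>u\<close> is vacuous, but the product is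
      0; otherwise the \<open>ennreal\<close> inverse is the real one.\<close>
    proof (cases "?m = 0")
      case False
      with m assms(4) show ?thesis
        by (simp add: inverse_ennreal ennreal_less_iff field_simps)
    qed simp
    then have "(\<bar>u\<bar> * ?m)\<^sup>2 < 1"
      using m(1) by (simp add: abs_square_less_1)
    then show ?thesis
      unfolding sq_N m(2) by (simp add: ennreal_mult[symmetric] power_mult_distrib ennreal_less_one_iff)
  qed
  have g: "g \<in> borel_measurable ?L" "sq_integral ?L g < \<infinity>"
    using assms(3) by (auto simp: square_integrable_iff)
  obtain f where f: "square_integrable a b f" "AE x in ?L. f x = g x + u * kernel_op f x"
    using fredholm_exists[OF g small] unfolding square_integrable_iff by blast
  \<comment> \<open>The class of \<open>f\<close> consists of exactly the square-integrable
    solutions.\<close>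
  have f_unique: "(f, h) \<in> L2_rel a b \<longleftrightarrow> solves_integral_equation a b M g u h"
    if h: "square_integrable a b h" for h
  proof
    assume "(f, h) \<in> L2_rel a b"
    then have eq: "AE x in ?L. f x = h x"
      by (simp add: L2_rel_def)
    \<comment> \<open>This holds at every point: changing \<open>f\<close> on a null set does not
      affect the integral over \<open>y\<close>.\<close>
    then have op_eq: "kernel_op f x = kernel_op h x" if "x \<in> space ?L" for x
      unfolding kernel_op_def using f h section_measurable[OF that]
      by (intro integral_cong_AE) (auto simp: square_integrable_iff)
    show "solves_integral_equation a b M g u h"
      unfolding solves_iff[OF h] using f(2) eq AE_space by eventually_elim (simp add: op_eq)
  next
    assume "solves_integral_equation a b M g u h"
    then have "AE x in ?L. h x = g x + u * kernel_op h x"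
      by (simp only: solves_iff[OF h])
    with f(2) have "AE x in ?L. f x = h x"
      by (rule fredholm_unique[OF _ _ _ _ small, rotated 4])
         (use f(1) h in \<open>simp_all add: square_integrable_iff\<close>)
    with f h show "(f, h) \<in> L2_rel a b"
      by (simp add: L2_rel_def)
  qed
  show ?thesis
  proof (rule ex1I)
    show "L2_rel a b `` {f} \<in> L2_space a b \<and>
        (\<forall>h\<in>L2_rel a b `` {f}. solves_integral_equation a b M g u h)"
      using f(1) f_unique by (auto simp: L2_space_def quotient_def L2_rel_def)
    fix F
    assume F: "F \<in> L2_space a b \<and> (\<forall>f\<in>F. solves_integral_equation a b M g u f)"
    \<comment> \<open>An equivalence class is nonempty, so the universal condition on
      \<open>F\<close> yields an actual solution \<open>h\<close>.\<close>
    then obtain h where h: "square_integrable a b h" "F = L2_rel a b `` {h}"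
      by (auto simp: L2_space_def quotient_def)
    then have "h \<in> F"
      by (simp add: L2_rel_def)
    with F h f_unique have "(f, h) \<in> L2_rel a b"
      by blast
    with h(2) show "F = L2_rel a b `` {f}"
      using equiv_class_eq[OF equiv_L2_rel] by metis
  qed
qed

end
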